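(* Let $n$ be a positive integer, $\alpha\in(n-1,n]$, $T>0$, $m\ge 1$ an integer and $h=T/m$. Let $S_{(m)}(t)=[S_0(t),\dots,S_{m-1}(t)]^{\top}$ be the vector of sample-and-hold functions and $T_{(m)}(t)=[T_0(t),\dots,T_{m-1}(t)]^{\top}$ the vector of right-handed triangular functions on $[0,T)$ with step size $h$. Then the (componentwise) Riemann--Liouville fractional integral of order $\alpha$ of $S_{(m)}$ is given in the orthogonal hybrid function domain by $$J^{\alpha}S_{(m)}(t)=\frac{1}{\Gamma(\alpha)}\int_0^t (t-\tau)^{\alpha-1}S_{(m)}(\tau)\,d\tau = P_{\alpha ss(m)}S_{(m)}(t)+P_{\alpha st(m)}T_{(m)}(t),$$ where the last equality means that, for each $i\in\{0,\dots,m-1\}$, the hybrid function expansion of the function $J^{\alpha}S_i$ is the $i$-th component (numbering from $0$) of $P_{\alpha ss(m)}S_{(m)}(t)+P_{\alpha st(m)}T_{(m)}(t)$. Here $P_{\alpha ss(m)}$ and $P_{\alpha st(m)}$ are the $m\times m$ matrices $$P_{\alpha ss(m)}=\frac{h^{\alpha}}{\Gamma(\alpha+1)}[\![0\ \ \varsigma_1\ \ \varsigma_2\ \cdots\ \varsigma_{m-1}]\!],\qquad \varsigma_k=k^{\alpha}-(k-1)^{\alpha},\quad k=1,\dots,m-1,$$ $$P_{\alpha st(m)}=\frac{h^{\alpha}}{\Gamma(\alpha+1)}[\![1\ \ \xi_1\ \ \xi_2\ \cdots\ \xi_{m-1}]\!],\qquad \xi_k=(k+1)^{\alpha}-2k^{\alpha}+(k-1)^{\alpha},\quad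 k=1,\dots,m-1.$$
   Context: Sample-and-hold functions: for $0\le i\le m-1$, $S_i(t)=1$ if $t\in[ih,(i+1)h)$ and $S_i(t)=0$ otherwise. Right-handed triangular functions: for $0\le i\le m-1$, $T_i(t)=\frac{t-ih}{h}$ if $t\in[ih,(i+1)h)$ and $T_i(t)=0$ otherwise. Hybrid function (HF) expansion: for a real function $f$ on $[0,T]$, its HF expansion (its representation "in the orthogonal hybrid function domain") is the function $$\sum_{i=0}^{m-1}\big(c_iS_i(t)+d_iT_i(t)\big),\qquad c_i=f(ih)\ \ (0\le i\le m),\qquad d_i=c_{i+1}-c_i\ \ (0\le i\le m-1),\qquad t\in[0,T).$$ Riemann--Liouville integral: $J^{\alpha}f(t)=\frac{1}{\Gamma(\alpha)}\int_0^t(t-\tau)^{\alpha-1}f(\tau)\,d\tau$ for $t\in[0,T]$ (in particular $J^\alpha f(0)=0$ for bounded $f$). Bracket notation: $[\![a_0\ a_1\ \cdots\ a_{m-1}]\!]$ denotes the $m\times m$ upper triangular Toeplitz matrix whose $(i,j)$ entry ($0\le i,j\le m-1$) is $a_{j-i}$ if $j\ge i$ and $0$ if $j<i$. The convention $0^{\alpha}=0$ is used. *)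

theory Defs
  imports "HOL-Analysis.Analysis" "Jordan_Normal_Form.Matrix"
begin

no_notation vec_nth (infixl "$" 90)

definition sample_hold :: "real \<Rightarrow> nat \<Rightarrow> real \<Rightarrow> real" where
  "sample_hold h i t = (if t \<in> {real i * h ..< (real i + 1) * h} then 1 else 0)"

definition triangular :: "real \<Rightarrow> nat \<Rightarrow> real \<Rightarrow> real" where
  "triangular h i t =
     (if t \<in> {real i * h ..< (real i + 1) * h} then (t - real i * h) / h else 0)"

definition sample_hold_vec :: "real \<Rightarrow> nat \<Rightarrow> real \<Rightarrow> real Matrix.vec" where
  "sample_hold_vec h m t = Matrix.vec m (\<lambda>i. sample_hold h i t)"

definition triangular_vec :: "real \<Rightarrow> nat \<Rightarrow> real \<Rightarrow> real Matrix.vec" where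
  "triangular_vec h m t = Matrix.vec m (\<lambda>i. triangular h i t)"

text \<open>The expansion, on \<open>[0, m h)\<close>, of a function on \<open>[0, m h]\<close>: the coefficients are
  \<open>c\<^sub>i = f (i h)\<close> and \<open>d\<^sub>i = c\<^sub>i\<^sub>+\<^sub>1 - c\<^sub>i\<close>, so the right end point value \<open>f (m h)\<close> is used.\<close>

definition hf_expansion :: "real \<Rightarrow> nat \<Rightarrow> (real \<Rightarrow> real) \<Rightarrow> real \<Rightarrow> real" where
  "hf_expansion h m f t =
     (\<Sum>i<m. f (real i * h) * sample_hold h i t
            + (f (real (i + 1) * h) - f (real i * h)) * triangular h i t)"

text \<open>A Lebesgue integral. For \<open>\<alpha> < 1\<close> the kernel is singular at the end point \<open>\<tau> = t\<close>, where
  \<open>0 powr (\<alpha> - 1) = 0\<close>; this is a null set and does not affect the value.\<close>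

definition rl_integral :: "real \<Rightarrow> (real \<Rightarrow> real) \<Rightarrow> real \<Rightarrow> real" where
  "rl_integral \<alpha> f t = 1 / Gamma \<alpha> * (LBINT \<tau>:{0..t}. (t - \<tau>) powr (\<alpha> - 1) * f \<tau>)"

text \<open>The bracket \<open>\<lbrakk>a\<^sub>0 a\<^sub>1 \<dots> a\<^sub>m\<^sub>-\<^sub>1\<rbrakk>\<close>; the list of entries determines the dimension.\<close>

definition upper_toeplitz :: "real list \<Rightarrow> real mat" where
  "upper_toeplitz as =
     mat (length as) (length as) (\<lambda>(i, j). if i \<le> j then as ! (j - i) else 0)"

text \<open>The convention \<open>0\<^sup>\<alpha> = 0\<close> is that of \<open>powr\<close>.\<close>

definition varsigma :: "real \<Rightarrow> nat \<Rightarrow> real" where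
  "varsigma \<alpha> k = real k powr \<alpha> - (real k - 1) powr \<alpha>"

definition xi :: "real \<Rightarrow> nat \<Rightarrow> real" where
  "xi \<alpha> k = (real k + 1) powr \<alpha> - 2 * real k powr \<alpha> + (real k - 1) powr \<alpha>"

definition P_ss :: "real \<Rightarrow> real \<Rightarrow> nat \<Rightarrow> real mat" where
  "P_ss \<alpha> h m =
     (h powr \<alpha> / Gamma (\<alpha> + 1)) \<cdot>\<^sub>m upper_toeplitz (0 # map (varsigma \<alpha>) [1..<m])"

definition P_st :: "real \<Rightarrow> real \<Rightarrow> nat \<Rightarrow> real mat" where
  "P_st \<alpha> h m =
     (h powr \<alpha> / Gamma (\<alpha> + 1)) \<cdot>\<^sub>m upper_toeplitz (1 # map (xi \<alpha>) [1..<m])"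

end

theory Submission
  imports Defs
begin

text \<open>Both sides are combinations of the same functions \<open>S\<^sub>j\<close> and \<open>T\<^sub>j\<close>, so the theorem is a
  comparison of coefficients. The coefficients of an expansion are determined by the values at the
  grid points \<open>j h\<close>, hence only the numbers \<open>J\<^sup>\<alpha> S\<^sub>i (j h)\<close> are needed. There the support of \<open>S\<^sub>i\<close>
  lies either to the right of \<open>j h\<close>, where the integral vanishes, or to its left, where integrating
  the kernel gives \<open>((j - i) h)\<^sup>\<alpha> - ((j - i - 1) h)\<^sup>\<alpha>\<close> up to the factor \<open>1 / \<Gamma> (\<alpha> + 1)\<close>
  (\<open>rl_integral_sample_hold_grid\<close>). These values depend on \<open>j - i\<close> only and form the Toeplitz matrix
  \<open>P\<^sub>s\<^sub>s\<close>. Their forward differences are the second differences \<open>\<xi>\<close> of the power function, with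
  the first one equal to \<open>\<varsigma>\<^sub>1 = 1\<close>, and form the matrix \<open>P\<^sub>s\<^sub>t\<close>.\<close>

text \<open>For \<open>\<alpha> < 1\<close> and \<open>b = t\<close> the integral is improper at \<open>b\<close>. The antiderivative
  \<open>- (t - \<tau>)\<^sup>\<alpha> / \<alpha>\<close> still has a limit there and the kernel is nonnegative, which suffices for the
  fundamental theorem of calculus on the open interval.\<close>

lemma set_integral_power_kernel:
  fixes a b t \<alpha> :: real
  assumes "0 < \<alpha>" "a < b" "b \<le> t"
  shows "(LBINT \<tau>:{a<..<b}. (t - \<tau>) powr (\<alpha> - 1))
         = ((t - a) powr \<alpha> - (t - b) powr \<alpha>) / \<alpha>"
proof -
  let ?F = "\<lambda>\<tau>. - ((t - \<tau>) powr \<alpha> / \<alpha>)"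
  \<comment> \<open>\<open>x powr \<alpha>\<close> tends to \<open>0\<close> as \<open>x\<close> decreases to \<open>0\<close>, so \<open>t\<close> is approached from the left;
    any other point is a point of continuity.\<close>
  have lim: "(?F \<longlongrightarrow> ?F c) (at c within A)" if "c < t \<or> A \<subseteq> {..t}" for c A
  proof (intro tendsto_intros tendsto_powr')
    show "t - c \<noteq> 0 \<or> 0 < \<alpha> \<and> (\<forall>\<^sub>F \<tau> in at c within A. 0 \<le> t - \<tau>)"
      using that assms(1) by (auto simp: eventually_at_filter intro!: always_eventually)
  qed (use assms(1) in simp)
  have "(LBINT \<tau>=ereal a..ereal b. (t - \<tau>) powr (\<alpha> - 1)) = ?F b - ?F a"
  proof (rule interval_integral_FTC_nonneg)
    show "ereal a < ereal b" using assms by simp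
    show "DERIV ?F \<tau> :> (t - \<tau>) powr (\<alpha> - 1)" if "ereal a < ereal \<tau>" "ereal \<tau> < ereal b" for \<tau>
      using that assms by (auto intro!: derivative_eq_intros)
    show "isCont (\<lambda>\<tau>. (t - \<tau>) powr (\<alpha> - 1)) \<tau>" if "ereal a < ereal \<tau>" "ereal \<tau> < ereal b" for \<tau>
      using that assms by (auto intro!: continuous_intros)
    show "AE \<tau> in lborel. ereal a < ereal \<tau> \<longrightarrow> ereal \<tau> < ereal b \<longrightarrow> 0 \<le> (t - \<tau>) powr (\<alpha> - 1)"
      by simp
    show "((?F \<circ> real_of_ereal) \<longlongrightarrow> ?F a) (at_right (ereal a))"
      by (simp only: ereal_tendsto_simps) (use assms in \<open>auto intro!: lim\<close>)
    show "((?F \<circ> real_of_ereal) \<longlongrightarrow> ?F b) (at_left (ereal b))"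
      by (simp only: ereal_tendsto_simps) (use assms in \<open>auto intro!: lim\<close>)
  qed
  moreover have "(LBINT \<tau>=ereal a..ereal b. (t - \<tau>) powr (\<alpha> - 1))
      = (LBINT \<tau>:{a<..<b}. (t - \<tau>) powr (\<alpha> - 1))"
    using assms by (simp add: interval_integral_Ioo)
  ultimately show ?thesis by (simp add: diff_divide_distrib)
qed

lemma rl_integral_sample_hold_before:
  assumes "t \<le> real i * h"
  shows "rl_integral \<alpha> (sample_hold h i) t = 0"
proof -
  \<comment> \<open>At \<open>\<tau> = t = i h\<close> the pulse has already started, but there the kernel is \<open>0 powr (\<alpha> - 1) = 0\<close>.\<close>
  have "indicator {0..t} \<tau> *\<^sub>R ((t - \<tau>) powr (\<alpha> - 1) * sample_hold h i \<tau>) = 0" for \<tau>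
    using assms by (cases "\<tau> = t") (auto simp: sample_hold_def indicator_def)
  then show ?thesis
    unfolding rl_integral_def set_lebesgue_integral_def by (simp only:) simp
qed

lemma rl_integral_sample_hold_after:
  assumes "0 < \<alpha>" "0 < h" "(real i + 1) * h \<le> t"
  shows "rl_integral \<alpha> (sample_hold h i) t
         = ((t - real i * h) powr \<alpha> - (t - (real i + 1) * h) powr \<alpha>) / Gamma (\<alpha> + 1)"
proof -
  let ?a = "real i * h" and ?b = "(real i + 1) * h"
  have ab: "0 \<le> ?a" "?a < ?b" using assms by (auto simp: algebra_simps)
  have "(LBINT \<tau>:{0..t}. (t - \<tau>) powr (\<alpha> - 1) * sample_hold h i \<tau>)
      = (LBINT \<tau>:{?a<..<?b}. (t - \<tau>) powr (\<alpha> - 1))"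
    unfolding set_lebesgue_integral_def
  proof (rule integral_cong_AE)
    show "AE \<tau> in lborel. indicator {0..t} \<tau> *\<^sub>R ((t - \<tau>) powr (\<alpha> - 1) * sample_hold h i \<tau>)
        = indicator {?a<..<?b} \<tau> *\<^sub>R (t - \<tau>) powr (\<alpha> - 1)"
      using AE_lborel_singleton[of ?a]
    proof eventually_elim
      case (elim \<tau>)
      then show ?case
        using ab assms(3) unfolding sample_hold_def indicator_def by auto
    qed
  qed (simp_all add: sample_hold_def)
  also have "\<dots> = ((t - ?a) powr \<alpha> - (t - ?b) powr \<alpha>) / \<alpha>"
    using assms ab by (intro set_integral_power_kernel) auto
  finally show ?thesis
    using assms Gamma_plus1[of \<alpha>] by (simp add: rl_integral_def nonpos_Ints_def)
qed

lemma rl_integral_sample_hold_grid: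
  assumes "0 < \<alpha>" "0 < h"
  shows "rl_integral \<alpha> (sample_hold h i) (real j * h)
         = h powr \<alpha> / Gamma (\<alpha> + 1) * (if i < j then varsigma \<alpha> (j - i) else 0)"
proof (cases "i < j")
  case True
  have grid: "(real i + 1) * h \<le> real j * h"
    using True assms by (intro mult_right_mono) auto
  have dist: "real j * h - real i * h = h * real (j - i)"
    "real j * h - (real i + 1) * h = h * (real (j - i) - 1)"
    using True by (simp_all add: of_nat_diff algebra_simps)
  show ?thesis
    unfolding rl_integral_sample_hold_after[OF assms grid] dist powr_mult
    using True by (simp add: varsigma_def right_diff_distrib diff_divide_distrib)
next
  case False
  then have "real j * h \<le> real i * h"
    using assms by (intro mult_right_mono) auto
  then show ?thesis using False by (simp add: rl_integral_sample_hold_before)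
qed

lemma xi_eq_varsigma_diff: "xi \<alpha> k = varsigma \<alpha> (Suc k) - varsigma \<alpha> k"
  by (simp add: xi_def varsigma_def add.commute)

lemma P_ss_index:
  assumes "i < m" "j < m"
  shows "P_ss \<alpha> h m $$ (i, j)
         = h powr \<alpha> / Gamma (\<alpha> + 1) * (if i < j then varsigma \<alpha> (j - i) else 0)"
  using assms by (auto simp: P_ss_def upper_toeplitz_def nth_Cons' simp flip: Suc_diff_Suc)

lemma P_st_index:
  assumes "i < m" "j < m"
  shows "P_st \<alpha> h m $$ (i, j)
         = h powr \<alpha> / Gamma (\<alpha> + 1)
           * (if j < i then 0 else if i = j then 1 else xi \<alpha> (j - i))"
  using assms by (auto simp: P_st_def upper_toeplitz_def nth_Cons' simp flip: Suc_diff_Suc)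

lemma P_ss_index_eq_rl_integral:
  assumes "0 < \<alpha>" "0 < h" "i < m" "j < m"
  shows "P_ss \<alpha> h m $$ (i, j) = rl_integral \<alpha> (sample_hold h i) (real j * h)"
  using assms by (simp add: P_ss_index rl_integral_sample_hold_grid)

lemma P_st_index_eq_rl_integral_diff:
  assumes "0 < \<alpha>" "0 < h" "i < m" "j < m"
  shows "P_st \<alpha> h m $$ (i, j)
         = rl_integral \<alpha> (sample_hold h i) (real (j + 1) * h)
           - rl_integral \<alpha> (sample_hold h i) (real j * h)"
proof -
  \<comment> \<open>The diagonal entry fits the pattern of differences because \<open>\<varsigma>\<^sub>1 = 1\<close>.\<close>
  have "varsigma \<alpha> (Suc 0) = 1" by (simp add: varsigma_def)
  then show ?thesis
    unfolding rl_integral_sample_hold_grid[OF assms(1,2)] P_st_index[OF assms(3,4)]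
    by (auto simp: xi_eq_varsigma_diff Suc_diff_le right_diff_distrib diff_divide_distrib less_Suc_eq)
qed

theorem theorem3p1:
  fixes n m :: nat and \<alpha> T h :: real
  assumes "n > 0"
    and "\<alpha> \<in> {real n - 1 <.. real n}"
    and "T > 0"
    and "m \<ge> 1"
    and "h = T / real m"
  shows "\<forall>i < m. \<forall>t \<in> {0 ..< T}.
           hf_expansion h m (rl_integral \<alpha> (sample_hold h i)) t
           = (P_ss \<alpha> h m *\<^sub>v sample_hold_vec h m t + P_st \<alpha> h m *\<^sub>v triangular_vec h m t) $ i"
proof (intro allI impI ballI)
  fix i t
  assume i: "i < m"
  have \<alpha>: "0 < \<alpha>" and h: "0 < h"
    using assms by auto
  have dim: "dim_row (P_ss \<alpha> h m) = m" "dim_col (P_ss \<alpha> h m) = m"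
    "dim_row (P_st \<alpha> h m) = m" "dim_col (P_st \<alpha> h m) = m"
    using assms(4) by (auto simp: P_ss_def P_st_def upper_toeplitz_def)
  have "(P_ss \<alpha> h m *\<^sub>v sample_hold_vec h m t + P_st \<alpha> h m *\<^sub>v triangular_vec h m t) $ i
      = (\<Sum>j<m. P_ss \<alpha> h m $$ (i, j) * sample_hold h j t
              + P_st \<alpha> h m $$ (i, j) * triangular h j t)"
    using i dim
    by (simp add: sample_hold_vec_def triangular_vec_def scalar_prod_def sum.distrib
        atLeast0LessThan)
  also have "\<dots> = hf_expansion h m (rl_integral \<alpha> (sample_hold h i)) t"
    unfolding hf_expansion_def using i
    by (intro sum.cong)
       (simp_all only: lessThan_iff P_ss_index_eq_rl_integral[OF \<alpha> h]
          P_st_index_eq_rl_integral_diff[OF \<alpha> h])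
  finally show "hf_expansion h m (rl_integral \<alpha> (sample_hold h i)) t
      = (P_ss \<alpha> h m *\<^sub>v sample_hold_vec h m t + P_st \<alpha> h m *\<^sub>v triangular_vec h m t) $ i" ..
qed

end
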